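(* Let $N\ge 2$, let $I\subset\mathbb{R}$ be an interval, $f:I\to I$ a map, $\varepsilon\in[0,1]$, and let $F_\varepsilon:I^N\to I^N$ be the globally coupled map lattice with local map $f$ and coupling intensity $\varepsilon$. Let $k\in\{2,\dots,N\}$ and let $x\in\mathcal{C}_k=\{x\in I^N: x_1=x_2=\dots=x_k\}$ be such that $F_\varepsilon$ is differentiable along the orbit $\{x^t\}_{t\in\mathbb{N}}$ of $x$ (where $x^t=F_\varepsilon^t(x)$ and $x^0=x$). Then, if it exists, the transverse Lyapunov exponent $\Lambda_k^{\bot}(x)$ of $x$ (which does not depend on the direction $\xi\in\mathbb{R}^N\setminus V_k^{\parallel}$ used to define it) is given by $$\Lambda^\bot_k(x)= \log(1-\varepsilon)+\lim_{n\to \infty} \frac1n \sum_{t=0}^{n-1}\log |f'(x_1^t)|.$$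
   Context: The globally coupled map lattice is the map $F_\varepsilon:I^N\to I^N$ given by $$F_\varepsilon(x)_i=(1-\varepsilon)f(x_i)+\frac{\varepsilon}{N}\sum_{j=1}^N f(x_j),\qquad i\in\{1,\dots,N\}.$$ The space $\mathcal{C}_k$ is forward invariant under $F_\varepsilon$; $x_1^t$ denotes the first coordinate of $x^t$. $V_k^{\parallel}\subset\mathbb{R}^N$ is the linear subspace $\{v\in\mathbb{R}^N: v_1=v_2=\dots=v_k\}$, spanned by $v^k=(1,\dots,1,0,\dots,0)$ (with $k$ ones) and the canonical basis vectors with indices $k+1,\dots,N$. $V_k^{\bot}$ is its orthogonal complement for the canonical inner product, and for $\xi\in\mathbb{R}^N$, $\xi_\bot$ denotes the orthogonal projection of $\xi$ on $V_k^\bot$. For $\xi\in\mathbb{R}^N\setminus V_k^{\parallel}$ and $x\in\mathcal{C}_k$ such that $F_\varepsilon$ is differentiable along the orbit of $x$, the transverse Lyapunov exponent of $x$ in the direction $\xi$ is, if the limit exists, $$\Lambda^\bot_k(x,\xi)=\lim_{n\to\infty}\frac1n\log\frac{\|(D_xF_\varepsilon^n\,\xi)_\bot\|}{\|\xi_\bot\|},$$ where $D_xF_\varepsilon^n$ is the Jacobian matrix of $F_\varepsilon^n$ at $x$. If it exists, it does not depend on the choice of $\xi\in\mathbb{R}^N\setminus V_k^{\parallel}$, and it is written $\Lambda_k^\bot(x)$.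
   Formalization: The interval is taken non-degenerate. For ε = 1, where log(1−ε) = −∞ and the limit on the right may fail to exist, the formula is read as: the exponent equals −∞. For ε < 1 the formula, with existence of the limit, is stated in full, with log 0 = −∞ allowed. *)

theory Defs
  imports "HOL-Analysis.Analysis"
begin

text \<open>
  The coordinates of \<open>real ^ 'n\<close> are ordered by the linear order of the finite index type \<open>'n\<close>
  (so \<open>N = CARD('n)\<close>): the \<open>m\<close>-th coordinate is the one whose index \<open>i\<close> satisfies
  \<open>card {..i} = m\<close>.
\<close>

definition first_index :: "'n::{finite,linorder}" where
  "first_index = Min UNIV"

definition first_indices :: "nat \<Rightarrow> 'n::{finite,linorder} set" where
  "first_indices k = {i. card {..i} \<le> k}"

definition cube :: "real set \<Rightarrow> (real ^ 'n) set" where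
  "cube I = {x. \<forall>i. x $ i \<in> I}"

definition gcml :: "(real \<Rightarrow> real) \<Rightarrow> real \<Rightarrow> real ^ 'n \<Rightarrow> real ^ 'n" where
  "gcml f \<epsilon> x = (\<chi> i. (1 - \<epsilon>) * f (x $ i) + \<epsilon> / real CARD('n) * (\<Sum>j\<in>UNIV. f (x $ j)))"

definition cluster_space :: "real set \<Rightarrow> nat \<Rightarrow> (real ^ 'n::{finite,linorder}) set" where
  "cluster_space I k = {x \<in> cube I. \<forall>i\<in>first_indices k. \<forall>j\<in>first_indices k. x $ i = x $ j}"

definition V_par :: "nat \<Rightarrow> (real ^ 'n::{finite,linorder}) set" where
  "V_par k = {v. \<forall>i\<in>first_indices k. \<forall>j\<in>first_indices k. v $ i = v $ j}"

definition V_perp :: "nat \<Rightarrow> (real ^ 'n::{finite,linorder}) set" where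
  "V_perp k = (V_par k)\<^sup>\<bottom>"

definition orth_proj :: "'a::euclidean_space set \<Rightarrow> 'a \<Rightarrow> 'a" where
  "orth_proj S v = (THE y. y \<in> S \<and> v - y \<in> S\<^sup>\<bottom>)"

text \<open>Unlike \<open>ln\<close>, for which \<open>ln 0 = 0\<close>, this logarithm of a nonnegative number satisfies
  \<open>log 0 = -\<infinity>\<close>.\<close>

definition eln :: "real \<Rightarrow> ereal" where
  "eln r = (if r = 0 then -\<infinity> else ereal (ln r))"

text \<open>
  The local map only lives on the interval \<open>I\<close>, so all derivatives are taken within \<open>I\<close> and
  \<open>cube I\<close>: two-sided in the interior, one-sided at endpoints belonging to \<open>I\<close>.
\<close>

definition differentiable_along_orbit ::
    "real set \<Rightarrow> (real \<Rightarrow> real) \<Rightarrow> real \<Rightarrow> real ^ 'n \<Rightarrow> bool" where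
  "differentiable_along_orbit I f \<epsilon> x \<longleftrightarrow>
     (\<forall>t. gcml f \<epsilon> differentiable (at ((gcml f \<epsilon> ^^ t) x) within cube I))"

definition deriv_within :: "real set \<Rightarrow> (real \<Rightarrow> real) \<Rightarrow> real \<Rightarrow> real" where
  "deriv_within I f y = vector_derivative f (at y within I)"

definition has_transverse_exponent ::
    "real set \<Rightarrow> (real \<Rightarrow> real) \<Rightarrow> real \<Rightarrow> nat \<Rightarrow>
     real ^ 'n::{finite,linorder} \<Rightarrow> real ^ 'n::{finite,linorder} \<Rightarrow> ereal \<Rightarrow> bool"
  where
  "has_transverse_exponent I f \<epsilon> k x \<xi> \<Lambda> \<longleftrightarrow>
     (\<lambda>n. ereal (1 / real n) *
        eln (norm (orth_proj (V_perp k) (jacobian (gcml f \<epsilon> ^^ n) (at x within cube I) *v \<xi>))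
             / norm (orth_proj (V_perp k) \<xi>)))
     \<longlonglongrightarrow> \<Lambda>"

end

theory Submission
  imports Defs
begin

text \<open>
  Summing the coordinates of the lattice map gives \<open>\<Sum>i. f (x $ i)\<close>, so differentiability of the
  lattice map at a point of the cube forces differentiability of \<open>f\<close> at every coordinate.
  At a point of the cluster space, the derivative of the lattice map then agrees with multiplication
  by \<open>(1 - \<epsilon>) * f' (x\<^sub>1)\<close> modulo \<open>V_par\<close>. By the chain rule, the derivative of the \<open>n\<close>-th iterate
  acts on the quotient by \<open>V_par\<close>, hence on the projection to \<open>V_perp\<close>, as the scalar
  \<open>\<Prod>t<n. (1 - \<epsilon>) * f' (x\<^sub>1\<^sup>t)\<close>, whatever the direction, and taking logarithms yields the formula.
\<close>

section \<open>Orthogonal projection on the transverse space\<close>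

text \<open>This makes the definite description usable: two candidates differ by a vector of
  \<open>S\<close> that is also in \<open>S\<^sup>\<bottom>\<close>, hence orthogonal to itself and
  zero.\<close>

lemma orth_proj_eqI:
  fixes S :: "'a::euclidean_space set"
  assumes "subspace S" "y \<in> S" "v - y \<in> S\<^sup>\<bottom>"
  shows "orth_proj S v = y"
  unfolding orth_proj_def
proof (rule the_equality)
  show "y \<in> S \<and> v - y \<in> S\<^sup>\<bottom>" using assms by simp
  fix z assume z: "z \<in> S \<and> v - z \<in> S\<^sup>\<bottom>"
  have "z - y \<in> S" using z assms by (simp add: subspace_diff)
  moreover have "(v - y) - (v - z) \<in> S\<^sup>\<bottom>"
    using z assms subspace_orthogonal_comp subspace_diff by blast
  ultimately have "z - y \<in> S \<inter> S\<^sup>\<bottom>" by simp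
  then have "orthogonal (z - y) (z - y)" by (auto simp: orthogonal_comp_def)
  then show "z = y" by (simp add: orthogonal_self)
qed

lemma orth_proj_mem:
  fixes S :: "'a::euclidean_space set"
  assumes "subspace S"
  shows "orth_proj S v \<in> S" "v - orth_proj S v \<in> S\<^sup>\<bottom>"
proof -
  have "v \<in> S + S\<^sup>\<bottom>" using subspace_sum_orthogonal_comp[OF assms] by simp
  then obtain y z where yz: "y \<in> S" "z \<in> S\<^sup>\<bottom>" "v = y + z"
    by (auto simp: set_plus_def)
  then have "orth_proj S v = y" by (intro orth_proj_eqI assms) auto
  then show "orth_proj S v \<in> S" "v - orth_proj S v \<in> S\<^sup>\<bottom>" using yz by auto
qed

text \<open>The projection is linear with kernel \<open>S\<^sup>\<bottom>\<close>, so a congruence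
  modulo that kernel becomes an equality of projections.\<close>

lemma orth_proj_eq_scaleR:
  fixes S :: "'a::euclidean_space set"
  assumes S: "subspace S" and "w - c *\<^sub>R v \<in> S\<^sup>\<bottom>"
  shows "orth_proj S w = c *\<^sub>R orth_proj S v"
proof (rule orth_proj_eqI[OF S])
  show "c *\<^sub>R orth_proj S v \<in> S" using orth_proj_mem[OF S] S by (simp add: subspace_scale)
  have "(w - c *\<^sub>R v) + c *\<^sub>R (v - orth_proj S v) \<in> S\<^sup>\<bottom>"
    using orth_proj_mem[OF S] assms
    by (intro subspace_add subspace_scale subspace_orthogonal_comp)
  then show "w - c *\<^sub>R orth_proj S v \<in> S\<^sup>\<bottom>" by (simp add: algebra_simps)
qed

lemma orth_proj_eq_0_iff:
  fixes S :: "'a::euclidean_space set"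
  assumes "subspace S"
  shows "orth_proj S v = 0 \<longleftrightarrow> v \<in> S\<^sup>\<bottom>"
  using orth_proj_mem(2)[OF assms, of v] orth_proj_eqI[OF assms subspace_0[OF assms], of v]
  by auto

section \<open>The space \<open>V_par\<close> and its orthogonal complement\<close>

lemma V_parI:
  "(\<And>i j. i \<in> first_indices k \<Longrightarrow> j \<in> first_indices k \<Longrightarrow> v $ i = v $ j) \<Longrightarrow> v \<in> V_par k"
  unfolding V_par_def by (intro CollectI ballI)

lemma V_parD:
  "v \<in> V_par k \<Longrightarrow> i \<in> first_indices k \<Longrightarrow> j \<in> first_indices k \<Longrightarrow> v $ i = v $ j"
  unfolding V_par_def by blast

lemma subspace_V_par: "subspace (V_par k)"
proof (rule subspaceI)
  show "0 \<in> V_par k" by (simp add: V_par_def)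
next
  fix u v :: "real ^ 'a::{finite,linorder}" assume u: "u \<in> V_par k" and v: "v \<in> V_par k"
  show "u + v \<in> V_par k"
    by (rule V_parI) (unfold vector_add_component, intro arg_cong2[where f = "(+)"] V_parD[OF u] V_parD[OF v])
next
  fix c u assume u: "u \<in> V_par k"
  show "c *\<^sub>R u \<in> V_par k"
    by (rule V_parI) (unfold vector_scaleR_component, intro arg_cong2[where f = "(*\<^sub>R)"] refl V_parD[OF u])
qed

lemma subspace_V_perp: "subspace (V_perp k)"
  by (simp add: V_perp_def subspace_orthogonal_comp)

lemma orthogonal_comp_V_perp: "(V_perp k)\<^sup>\<bottom> = V_par k"
  by (simp add: V_perp_def orthogonal_comp_self subspace_V_par)

lemma first_index_in_first_indices:
  assumes "1 \<le> k"
  shows "first_index \<in> first_indices k"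
proof -
  have "{..first_index :: 'a} = {first_index}"
    unfolding first_index_def by (auto intro!: antisym Min_le)
  then show ?thesis using assms by (simp add: first_indices_def)
qed

section \<open>Derivatives of the lattice map\<close>

text \<open>Nonempty interior excludes singletons, and a connected set with more than one point is
  perfect.\<close>

lemma interval_islimpt:
  fixes I :: "real set"
  assumes "is_interval I" "interior I \<noteq> {}" "a \<in> I"
  shows "a islimpt I"
proof -
  have "I \<noteq> {z}" for z
    using assms(2) by auto
  then show ?thesis
    using assms by (intro connected_imp_perfect is_interval_connected)
qed

text \<open>Uniqueness also holds at boundary points: the cube is a product, so replacing one
  coordinate by a nearby point of \<open>I\<close> stays inside it and gives arbitrarily small
  nonzero displacements along every axis.\<close>

lemma has_derivative_unique_within_cube:
  fixes g :: "real ^ 'n \<Rightarrow> 'b::real_normed_vector"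
  assumes I: "is_interval I" "interior I \<noteq> {}" and x: "x \<in> cube I"
    and "(g has_derivative A) (at x within cube I)"
    and "(g has_derivative B) (at x within cube I)"
  shows "A = B"
proof (rule frechet_derivative_unique_within[OF assms(4,5)])
  fix b :: "real ^ 'n" and e :: real
  assume "b \<in> Basis" and e: "e > 0"
  then obtain j where b: "b = axis j 1" by (auto simp: Basis_vec_def)
  have xI: "x $ i \<in> I" for i using x by (simp add: cube_def)
  obtain z where z: "z \<in> I" "z \<noteq> x $ j" "dist z (x $ j) < e"
    using interval_islimpt[OF I xI] e by (auto simp: islimpt_approachable)
  have "(x + (z - x $ j) *\<^sub>R b) $ i \<in> I" for i
    using xI[of i] z by (cases "i = j") (auto simp: b axis_def)
  then have "x + (z - x $ j) *\<^sub>R b \<in> cube I" by (simp add: cube_def)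
  then show "\<exists>d. 0 < \<bar>d\<bar> \<and> \<bar>d\<bar> < e \<and> x + d *\<^sub>R b \<in> cube I"
    using z by (intro exI[of _ "z - x $ j"]) (auto simp: dist_real_def)
qed

text \<open>\<open>jacobian\<close> is the matrix of some chosen derivative; uniqueness identifies
  it with whichever derivative has been computed.\<close>

lemma jacobian_within_cube_mult:
  fixes g :: "real ^ 'n \<Rightarrow> real ^ 'm"
  assumes "is_interval I" "interior I \<noteq> {}" "x \<in> cube I"
    and D: "(g has_derivative D) (at x within cube I)"
  shows "jacobian g (at x within cube I) *v v = D v"
proof -
  have "(g has_derivative (\<lambda>h. jacobian g (at x within cube I) *v h)) (at x within cube I)"
    using D jacobian_works differentiableI by blast
  from has_derivative_unique_within_cube[OF assms(1-3) this D] show ?thesis by metis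
qed

text \<open>Each new coordinate is a convex combination of \<open>f (x $ i)\<close> and the mean of
  all the \<open>f (x $ j)\<close>, and an interval is convex.\<close>

lemma gcml_in_cube:
  assumes f: "f \<in> I \<rightarrow> I" and I: "is_interval I" and eps: "\<epsilon> \<in> {0..1}" and x: "x \<in> cube I"
  shows "gcml f \<epsilon> (x :: real ^ 'n) \<in> cube I"
proof -
  have fx: "f (x $ i) \<in> I" for i using f x by (auto simp: cube_def)
  have conv: "convex I" using I by (simp add: is_interval_convex)
  have "(\<Sum>j\<in>UNIV. (1 / real CARD('n)) *\<^sub>R f (x $ j)) \<in> I"
    by (rule convex_sum[OF _ conv]) (auto simp: fx)
  then have m: "(\<Sum>j\<in>UNIV. f (x $ j)) / real CARD('n) \<in> I"
    by (simp add: sum_divide_distrib)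
  have "(1 - \<epsilon>) *\<^sub>R f (x $ i) + \<epsilon> *\<^sub>R ((\<Sum>j\<in>UNIV. f (x $ j)) / real CARD('n)) \<in> I" for i
    by (rule convexD[OF conv fx m]) (use eps in auto)
  then show ?thesis by (simp add: cube_def gcml_def)
qed

lemma gcml_in_cluster_space:
  assumes "f \<in> I \<rightarrow> I" "is_interval I" "\<epsilon> \<in> {0..1}" "x \<in> cluster_space I k"
  shows "gcml f \<epsilon> x \<in> cluster_space I k"
proof -
  have "gcml f \<epsilon> x \<in> cube I"
    using assms unfolding cluster_space_def by (blast intro: gcml_in_cube)
  moreover have "gcml f \<epsilon> x $ i = gcml f \<epsilon> x $ j"
    if "i \<in> first_indices k" "j \<in> first_indices k" for i j
  proof -
    have "x $ i = x $ j" using assms(4) that unfolding cluster_space_def by blast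
    then show ?thesis by (simp add: gcml_def)
  qed
  ultimately show ?thesis unfolding cluster_space_def by blast
qed

lemma sum_gcml: "(\<Sum>i\<in>UNIV. gcml f \<epsilon> (x :: real ^ 'n) $ i) = (\<Sum>i\<in>UNIV. f (x $ i))"
proof -
  have "(\<Sum>i\<in>UNIV. gcml f \<epsilon> x $ i)
      = (1 - \<epsilon>) * (\<Sum>i\<in>UNIV. f (x $ i)) + \<epsilon> * (\<Sum>i\<in>UNIV. f (x $ i))"
    by (simp add: gcml_def sum.distrib sum_distrib_left)
  then show ?thesis by (simp add: algebra_simps)
qed

text \<open>Individual coordinates need not isolate \<open>f\<close>, but their sum does, for every
  \<epsilon> including 1: when only coordinate \<open>i\<close> moves, the sum is \<open>f s\<close>
  plus a constant.\<close>

lemma local_map_differentiable: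
  fixes x :: "real ^ 'n"
  assumes x: "x \<in> cube I" and diff: "gcml f \<epsilon> differentiable (at x within cube I)"
  shows "f differentiable (at (x $ i) within I)"
proof -
  define g where "g s = x + (s - x $ i) *\<^sub>R axis i (1 :: real)" for s
  have gnth: "g s $ j = (if j = i then s else x $ j)" for s j
    by (simp add: g_def axis_def)
  have gI: "g ` I \<subseteq> cube I" using x by (auto simp: cube_def gnth)
  have gx: "g (x $ i) = x" by (simp add: g_def)
  have gd: "g differentiable (at (x $ i) within I)"
    unfolding g_def by (intro derivative_intros)
  have "gcml f \<epsilon> differentiable (at (g (x $ i)) within g ` I)"
    unfolding gx using diff gI differentiable_within_subset by blast
  then have "(gcml f \<epsilon> \<circ> g) differentiable (at (x $ i) within I)"
    by (rule differentiable_chain_within[OF gd])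
  then have comp: "(\<lambda>s. gcml f \<epsilon> (g s) $ j) differentiable (at (x $ i) within I)" for j
    using differentiable_chain_within[OF _ bounded_linear_imp_differentiable[OF bounded_linear_vec_nth]]
    by (simp add: o_def)
  have "(\<lambda>s. (\<Sum>j\<in>UNIV. gcml f \<epsilon> (g s) $ j) - (\<Sum>j\<in>UNIV - {i}. f (x $ j)))
      differentiable (at (x $ i) within I)"
    using comp by (intro differentiable_diff differentiable_sum differentiable_const) auto
  moreover have "(\<Sum>j\<in>UNIV. gcml f \<epsilon> (g s) $ j) - (\<Sum>j\<in>UNIV - {i}. f (x $ j)) = f s" for s
    by (simp add: sum_gcml sum.remove[of UNIV i] gnth)
  ultimately show ?thesis by simp
qed

lemma has_derivative_gcml:
  fixes x :: "real ^ 'n"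
  assumes x: "x \<in> cube I" and f: "\<And>i. (f has_real_derivative d i) (at (x $ i) within I)"
  shows "(gcml f \<epsilon> has_derivative
      (\<lambda>h. \<chi> i. (1 - \<epsilon>) * (d i * h $ i) + \<epsilon> / real CARD('n) * (\<Sum>j\<in>UNIV. d j * h $ j)))
    (at x within cube I)"
proof -
  have coord: "((\<lambda>y. f (y $ i)) has_derivative (\<lambda>h. d i * h $ i)) (at x within cube I)" for i
  proof -
    have nth: "((\<lambda>y. y $ i) has_derivative (\<lambda>h. h $ i)) (at x within cube I)"
      by (rule bounded_linear_imp_has_derivative[OF bounded_linear_vec_nth])
    have "(f has_derivative (*) (d i)) (at (x $ i) within (\<lambda>y. y $ i) ` cube I)"
      by (rule has_derivative_subset[OF f[unfolded has_field_derivative_def]])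
        (auto simp: cube_def)
    from has_derivative_in_compose[OF nth this] show ?thesis by simp
  qed
  show ?thesis
    unfolding gcml_def
    by (subst has_derivative_componentwise_within)
      (auto simp: Basis_vec_def inner_axis simp del: times_divide_eq_left
        intro!: has_derivative_add has_derivative_mult_right has_derivative_sum coord)
qed

text \<open>The coupling term is the same in every coordinate, hence in \<open>V_par k\<close>, and
  the diagonal factors agree on the first \<open>k\<close> coordinates because the point is
  synchronized there.\<close>

lemma gcml_derivative_mod_V_par:
  fixes x :: "real ^ 'n::{finite,linorder}"
  assumes x: "x \<in> cluster_space I k" and k: "1 \<le> k"
    and diff: "gcml f \<epsilon> differentiable (at x within cube I)"
  obtains A where "(gcml f \<epsilon> has_derivative A) (at x within cube I)"
    and "\<And>h. A h - ((1 - \<epsilon>) * deriv_within I f (x $ first_index)) *\<^sub>R h \<in> V_par k"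
proof -
  have xc: "x \<in> cube I" using x by (simp add: cluster_space_def)
  define d where "d i = deriv_within I f (x $ i)" for i
  have f: "(f has_real_derivative d i) (at (x $ i) within I)" for i
    using local_map_differentiable[OF xc diff, of i]
    by (simp add: d_def deriv_within_def vector_derivative_works
        has_real_derivative_iff_has_vector_derivative)
  have d: "d i = d first_index" if "i \<in> first_indices k" for i
  proof -
    have "x $ i = x $ first_index"
      using that x first_index_in_first_indices[OF k] unfolding cluster_space_def by blast
    then show ?thesis by (simp add: d_def)
  qed
  let ?A = "\<lambda>h :: real ^ 'n::{finite,linorder}.
    (\<chi> i. (1 - \<epsilon>) * (d i * h $ i) + \<epsilon> / real CARD('n::{finite,linorder}) * (\<Sum>j\<in>UNIV. d j * h $ j))"
  have "?A h - ((1 - \<epsilon>) * d first_index) *\<^sub>R h \<in> V_par k" for h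
    by (rule V_parI) (auto dest!: d)
  then show ?thesis
    using that[OF has_derivative_gcml[OF xc f]] by (simp add: d_def)
qed

lemma gcml_funpow_derivative_mod_V_par:
  fixes x :: "real ^ 'n::{finite,linorder}"
  assumes I: "is_interval I" and f: "f \<in> I \<rightarrow> I" and eps: "\<epsilon> \<in> {0..1}"
    and k: "1 \<le> k" and x: "x \<in> cluster_space I k"
    and diff: "differentiable_along_orbit I f \<epsilon> x"
  shows "\<exists>D. (gcml f \<epsilon> ^^ n has_derivative D) (at x within cube I) \<and>
    (\<forall>h. D h - (\<Prod>t<n. (1 - \<epsilon>) * deriv_within I f ((gcml f \<epsilon> ^^ t) x $ first_index)) *\<^sub>R h
      \<in> V_par k)"
proof (induction n)
  case 0
  have "((gcml f \<epsilon> ^^ 0) has_derivative (\<lambda>h. h)) (at x within cube I)"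
    by (simp add: id_def)
  then show ?case using subspace_0[OF subspace_V_par] by (intro exI[of _ "\<lambda>h. h"]) simp
next
  case (Suc n)
  let ?y = "(gcml f \<epsilon> ^^ n) x"
  let ?d = "(1 - \<epsilon>) * deriv_within I f (?y $ first_index)"
  let ?p = "\<Prod>t<n. (1 - \<epsilon>) * deriv_within I f ((gcml f \<epsilon> ^^ t) x $ first_index)"
  from Suc obtain D where D: "(gcml f \<epsilon> ^^ n has_derivative D) (at x within cube I)"
    and Dp: "\<And>h. D h - ?p *\<^sub>R h \<in> V_par k" by blast
  have y: "?y \<in> cluster_space I k"
    by (induction n) (auto simp: x intro!: gcml_in_cluster_space f I eps)
  obtain A where A: "(gcml f \<epsilon> has_derivative A) (at ?y within cube I)"
    and Ad: "\<And>h. A h - ?d *\<^sub>R h \<in> V_par k"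
    using gcml_derivative_mod_V_par[OF y k] diff unfolding differentiable_along_orbit_def by metis
  \<comment> \<open>The chain rule needs the derivative of the outer map within the image of the
    cube, which invariance places inside the cube.\<close>
  have "(gcml f \<epsilon> ^^ n) z \<in> cube I" if "z \<in> cube I" for z
    by (induction n) (auto simp: that intro!: gcml_in_cube f I eps)
  then have "(gcml f \<epsilon> has_derivative A) (at ?y within (gcml f \<epsilon> ^^ n) ` cube I)"
    using has_derivative_subset[OF A] by blast
  from diff_chain_within[OF D this]
  have "(gcml f \<epsilon> ^^ Suc n has_derivative A \<circ> D) (at x within cube I)" by simp
  moreover have "(A \<circ> D) h -
      (\<Prod>t<Suc n. (1 - \<epsilon>) * deriv_within I f ((gcml f \<epsilon> ^^ t) x $ first_index)) *\<^sub>R h \<in> V_par k"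
    for h
  proof -
    \<comment> \<open>Both errors lie in \<open>V_par k\<close>: the one made by \<open>A\<close> at
      \<open>D h\<close>, and the earlier one rescaled by \<open>?d\<close>.\<close>
    have "(A (D h) - ?d *\<^sub>R D h) + ?d *\<^sub>R (D h - ?p *\<^sub>R h) \<in> V_par k"
      by (intro subspace_add subspace_scale subspace_V_par Ad Dp)
    then show ?thesis by (simp add: algebra_simps)
  qed
  ultimately show ?case by blast
qed

lemma transverse_growth:
  fixes x \<eta> :: "real ^ 'n::{finite,linorder}"
  assumes I: "is_interval I" "interior I \<noteq> {}" and f: "f \<in> I \<rightarrow> I" and eps: "\<epsilon> \<in> {0..1}"
    and k: "1 \<le> k" and x: "x \<in> cluster_space I k"
    and diff: "differentiable_along_orbit I f \<epsilon> x" and \<eta>: "\<eta> \<notin> V_par k"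
  shows "norm (orth_proj (V_perp k) (jacobian (gcml f \<epsilon> ^^ n) (at x within cube I) *v \<eta>))
      / norm (orth_proj (V_perp k) \<eta>)
    = (1 - \<epsilon>) ^ n * (\<Prod>t<n. \<bar>deriv_within I f ((gcml f \<epsilon> ^^ t) x $ first_index)\<bar>)"
proof -
  let ?p = "\<Prod>t<n. (1 - \<epsilon>) * deriv_within I f ((gcml f \<epsilon> ^^ t) x $ first_index)"
  obtain D where D: "(gcml f \<epsilon> ^^ n has_derivative D) (at x within cube I)"
    and Dp: "\<And>h. D h - ?p *\<^sub>R h \<in> V_par k"
    using gcml_funpow_derivative_mod_V_par[OF I(1) f eps k x diff] by blast
  have xc: "x \<in> cube I" using x by (simp add: cluster_space_def)
  have "orth_proj (V_perp k) (D \<eta>) = ?p *\<^sub>R orth_proj (V_perp k) \<eta>"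
    by (intro orth_proj_eq_scaleR subspace_V_perp) (simp add: orthogonal_comp_V_perp Dp)
  \<comment> \<open>A nonzero denominator lets the projected direction cancel, so the ratio is
    independent of \<eta>.\<close>
  moreover have "orth_proj (V_perp k) \<eta> \<noteq> 0"
    using \<eta> by (simp add: orth_proj_eq_0_iff subspace_V_perp orthogonal_comp_V_perp)
  ultimately show ?thesis
    using eps
    by (simp add: jacobian_within_cube_mult[OF I xc D] abs_prod abs_mult prod.distrib)
qed

section \<open>Extended logarithms\<close>

lemma eln_mult: "0 \<le> a \<Longrightarrow> 0 \<le> b \<Longrightarrow> eln (a * b) = eln a + eln b"
  by (auto simp: eln_def ln_mult)

lemma eln_prod:
  assumes "\<And>i. i \<in> A \<Longrightarrow> 0 \<le> g i"
  shows "eln (\<Prod>i\<in>A. g i) = (\<Sum>i\<in>A. eln (g i))"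
  using assms
proof (induction A rule: infinite_finite_induct)
  case (insert i A)
  then show ?case by (simp add: eln_mult prod_nonneg)
qed (simp_all add: eln_def zero_ereal_def)

text \<open>For \<open>b = 0\<close> both sides are minus infinity, since \<open>eln c\<close> is
  finite and \<open>1 / real n\<close> is positive.\<close>

lemma eln_power_mult:
  assumes "0 < c" "0 \<le> b" "0 < n"
  shows "ereal (1 / real n) * eln (c ^ n * b) = eln c + ereal (1 / real n) * eln b"
proof -
  have "eln (c ^ n * b) = ereal (real n * ln c) + eln b"
    using assms by (simp add: eln_mult) (simp add: eln_def ln_realpow)
  then show ?thesis
    using assms by (cases "eln b") (auto simp: eln_def field_simps split: if_splits)
qed

section \<open>The formula for the transverse exponent\<close>

theorem theorem3p2:
  fixes I :: "real set" and f :: "real \<Rightarrow> real" and \<epsilon> :: real and k :: nat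
    and x \<xi> :: "real ^ 'n::{finite,linorder}" and \<Lambda> :: ereal
  assumes N: "CARD('n) \<ge> 2"
    and I: "is_interval I" "interior I \<noteq> {}"
    and f: "f \<in> I \<rightarrow> I"
    and eps: "\<epsilon> \<in> {0..1}"
    and k: "k \<in> {2..CARD('n)}"
    and x: "x \<in> cluster_space I k"
    and diff: "differentiable_along_orbit I f \<epsilon> x"
    and xi: "\<xi> \<notin> V_par k"
    and ex: "has_transverse_exponent I f \<epsilon> k x \<xi> \<Lambda>"
  shows "(\<forall>\<eta>. \<eta> \<notin> V_par k \<longrightarrow> has_transverse_exponent I f \<epsilon> k x \<eta> \<Lambda>) \<and>
    (\<epsilon> < 1 \<longrightarrow>
      (\<exists>L. (\<lambda>n. ereal (1 / real n) *
               (\<Sum>t<n. eln \<bar>deriv_within I f ((gcml f \<epsilon> ^^ t) x $ first_index)\<bar>)) \<longlonglongrightarrow> L \<and>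
           \<Lambda> = eln (1 - \<epsilon>) + L)) \<and>
    (\<epsilon> = 1 \<longrightarrow> \<Lambda> = -\<infinity>)"
proof -
  define d where "d t = \<bar>deriv_within I f ((gcml f \<epsilon> ^^ t) x $ first_index)\<bar>" for t
  have k1: "1 \<le> k" using k by simp
  have exponent_iff: "has_transverse_exponent I f \<epsilon> k x \<eta> \<Lambda> \<longleftrightarrow>
      (\<lambda>n. ereal (1 / real n) * eln ((1 - \<epsilon>) ^ n * (\<Prod>t<n. d t))) \<longlonglongrightarrow> \<Lambda>"
    if "\<eta> \<notin> V_par k" for \<eta>
    unfolding has_transverse_exponent_def d_def
    by (simp only: transverse_growth[OF I f eps k1 x diff that])
  have lim: "(\<lambda>n. ereal (1 / real n) * eln ((1 - \<epsilon>) ^ n * (\<Prod>t<n. d t))) \<longlonglongrightarrow> \<Lambda>"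
    using ex exponent_iff[OF xi] by simp
  have "\<exists>L. (\<lambda>n. ereal (1 / real n) * (\<Sum>t<n. eln (d t))) \<longlonglongrightarrow> L \<and> \<Lambda> = eln (1 - \<epsilon>) + L"
    if e: "\<epsilon> < 1"
  proof -
    define c where "c = ln (1 - \<epsilon>)"
    have c: "eln (1 - \<epsilon>) = ereal c" using e by (simp add: eln_def c_def)
    \<comment> \<open>At \<open>n = 0\<close> the left side is 0 and the right side is
      \<open>c\<close>, so the sequences are only compared eventually.\<close>
    have step: "ereal (1 / real n) * eln ((1 - \<epsilon>) ^ n * (\<Prod>t<n. d t))
        = ereal c + ereal (1 / real n) * (\<Sum>t<n. eln (d t))" if "0 < n" for n
      using eln_power_mult[of "1 - \<epsilon>" "\<Prod>t<n. d t" n] e that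
      by (simp add: c prod_nonneg d_def eln_prod)
    \<comment> \<open>As \<open>c\<close> is finite, it can be subtracted even from infinite values;
      the limit of the averages is then \<open>\<Lambda> + ereal (- c)\<close>.\<close>
    have cancel: "(ereal c + z) + ereal (- c) = z" "ereal c + (z + ereal (- c)) = z" for z
      by (cases z; simp)+
    have "(\<lambda>n. ereal c + ereal (1 / real n) * (\<Sum>t<n. eln (d t))) \<longlonglongrightarrow> \<Lambda>"
      by (rule Lim_transform_eventually[OF lim])
        (use step in \<open>auto simp: eventually_sequentially simp del: sum_ereal intro!: exI[of _ 1]\<close>)
    then have "(\<lambda>n. (ereal c + ereal (1 / real n) * (\<Sum>t<n. eln (d t))) + ereal (- c))
        \<longlonglongrightarrow> \<Lambda> + ereal (- c)"
      by (intro tendsto_add_left_ereal) auto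
    then have "(\<lambda>n. ereal (1 / real n) * (\<Sum>t<n. eln (d t))) \<longlonglongrightarrow> \<Lambda> + ereal (- c)"
      by (simp only: cancel)
    then show ?thesis using cancel(2) c by metis
  qed
  \<comment> \<open>Here the product vanishes for all \<open>n > 0\<close> whatever \<open>f\<close>
    does, so the exponent says nothing about the averages of the logarithms.\<close>
  moreover have "\<Lambda> = -\<infinity>" if "\<epsilon> = 1"
  proof -
    have "(\<lambda>n. -\<infinity> :: ereal) \<longlonglongrightarrow> \<Lambda>"
      by (rule Lim_transform_eventually[OF lim])
        (auto simp: eventually_sequentially that eln_def power_0_left intro!: exI[of _ 1])
    then show ?thesis using LIMSEQ_unique tendsto_const by blast
  qed
  ultimately show ?thesis
    using exponent_iff lim by (auto simp: d_def)
qed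

end
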